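(* Assume there are only finitely many $n$ with $\Delta_{n-1}\Delta_n>0$ and that $\prod_{n\ge0}\{\beta_n\}=0$. Then $\Delta_n\to0$ as $n\to\infty$.
   Context: For real $x$ let $[x]$ be the greatest integer $\le x$ and $\{x\}=x-[x]$. Let $(\alpha_0,\beta_0)\in\mathbf{R}^2$ with $0\le\alpha_0\le\beta_0$, $1\le\beta_0$, and assume $1,\alpha_0,\beta_0$ are linearly independent over $\mathbf{Q}$. The Jacobi-Perron algorithm (dimension 2) defines, for $n\ge1$, $\alpha_n=\{\beta_{n-1}\}/\{\alpha_{n-1}\}$ and $\beta_n=1/\{\alpha_{n-1}\}$ (under the independence assumption all $\{\alpha_n\},\{\beta_n\}$ are nonzero, so this is defined for all $n$). Put $a_n=[\alpha_n]$, $b_n=[\beta_n]$ for $n\ge0$. Define $(r_{-2},r_{-1},r_0)=(0,0,1)$, $(p_{-2},p_{-1},p_0)=(1,0,a_0)$, $(q_{-2},q_{-1},q_0)=(0,1,b_0)$, and for $n\ge1$: $r_n=r_{n-1}b_n+r_{n-2}a_n+r_{n-3}$, $p_n=p_{n-1}b_n+p_{n-2}a_n+p_{n-3}$, $q_n=q_{n-1}b_n+q_{n-2}a_n+q_{n-3}$. Set $\Delta_n=p_n-\alpha_0 r_n$ for $n\ge0$. The infinite product denotes the limit of its (decreasing, positive) partial products. *)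

theory Defs
  imports Complex_Main
begin

text \<open>Linear independence over the rationals of the family (1, x, y). It is stated for the family
  rather than for the set {1, x, y}, so that a coincidence such as x = y counts as a dependence.\<close>

definition lin_indep_one :: "real \<Rightarrow> real \<Rightarrow> bool" where
  "lin_indep_one x y \<longleftrightarrow>
     (\<forall>u v w :: rat. of_rat u + of_rat v * x + of_rat w * y = 0 \<longrightarrow> u = 0 \<and> v = 0 \<and> w = 0)"

text \<open>The two complete quotients of the Jacobi-Perron algorithm started at (x, y).\<close>

fun jp_alpha :: "real \<Rightarrow> real \<Rightarrow> nat \<Rightarrow> real"
  and jp_beta :: "real \<Rightarrow> real \<Rightarrow> nat \<Rightarrow> real" where
  "jp_alpha x y 0 = x"
| "jp_alpha x y (Suc n) = frac (jp_beta x y n) / frac (jp_alpha x y n)"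
| "jp_beta x y 0 = y"
| "jp_beta x y (Suc n) = 1 / frac (jp_alpha x y n)"

definition jp_a :: "real \<Rightarrow> real \<Rightarrow> nat \<Rightarrow> int" where
  "jp_a x y n = \<lfloor>jp_alpha x y n\<rfloor>"

definition jp_b :: "real \<Rightarrow> real \<Rightarrow> nat \<Rightarrow> int" where
  "jp_b x y n = \<lfloor>jp_beta x y n\<rfloor>"

text \<open>The solution of s(n) = s(n-1) b(n) + s(n-2) a(n) + s(n-3) for n \<ge> 1 with
  s(-2), s(-1), s(0) = s0, s1, s2. The index is shifted by 2, so that
  jp_rec a b s0 s1 s2 (n + 2) is the mathematical s(n).\<close>

fun jp_rec :: "(nat \<Rightarrow> int) \<Rightarrow> (nat \<Rightarrow> int) \<Rightarrow> int \<Rightarrow> int \<Rightarrow> int \<Rightarrow> nat \<Rightarrow> int" where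
  "jp_rec a b s0 s1 s2 0 = s0"
| "jp_rec a b s0 s1 s2 (Suc 0) = s1"
| "jp_rec a b s0 s1 s2 (Suc (Suc 0)) = s2"
| "jp_rec a b s0 s1 s2 (Suc (Suc (Suc k))) =
     jp_rec a b s0 s1 s2 (Suc (Suc k)) * b (Suc k)
     + jp_rec a b s0 s1 s2 (Suc k) * a (Suc k)
     + jp_rec a b s0 s1 s2 k"

definition jp_r :: "real \<Rightarrow> real \<Rightarrow> nat \<Rightarrow> int" where
  "jp_r x y n = jp_rec (jp_a x y) (jp_b x y) 0 0 1 (n + 2)"

definition jp_p :: "real \<Rightarrow> real \<Rightarrow> nat \<Rightarrow> int" where
  "jp_p x y n = jp_rec (jp_a x y) (jp_b x y) 1 0 (jp_a x y 0) (n + 2)"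

definition jp_Delta :: "real \<Rightarrow> real \<Rightarrow> nat \<Rightarrow> real" where
  "jp_Delta x y n = of_int (jp_p x y n) - x * of_int (jp_r x y n)"

end

theory Submission
  imports Defs
begin

text \<open>The errors \<open>\<Delta>\<^sub>n\<close> obey the same three-term recurrence as the numerators and denominators, and
  the complete quotients annihilate them: \<open>\<beta>\<^sub>n \<Delta>\<^bsub>n-1\<^esub> + \<alpha>\<^sub>n \<Delta>\<^bsub>n-2\<^esub> + \<Delta>\<^bsub>n-3\<^esub> = 0\<close>. Subtracting this
  from the recurrence replaces the partial quotients by fractional parts and eliminates the third
  term:
  \<open>\<Delta>\<^sub>n = - {\<beta>\<^sub>n} \<Delta>\<^bsub>n-1\<^esub> - {\<alpha>\<^sub>n} \<Delta>\<^bsub>n-2\<^esub>\<close> (lemma \<open>jp_Delta_frac_recurrence\<close>).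

  No \<open>\<Delta>\<^sub>n\<close> vanishes, so once consecutive errors no longer have the same sign they alternate
  strictly. Then \<open>\<Delta>\<^bsub>n-2\<^esub>\<close> has the sign of \<open>\<Delta>\<^sub>n\<close>, the last term works against the first one, and
  \<open>\<bar>\<Delta>\<^sub>n\<bar> \<le> {\<beta>\<^sub>n} \<bar>\<Delta>\<^bsub>n-1\<^esub>\<bar>\<close>. Hence \<open>\<bar>\<Delta>\<^sub>n\<bar>\<close> is eventually bounded by a constant times the partial
  product of the \<open>{\<beta>\<^sub>i}\<close>; the constant is finite because linear independence is inherited by all
  complete quotients, which keeps the factors that precede the alternating range from being zero.\<close>

lemma lin_indep_one_frac_nonzero:
  assumes "lin_indep_one x y"
  shows "frac x \<noteq> 0" and "frac y \<noteq> 0"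
proof -
  have "x \<noteq> of_int m" for m
    using assms[unfolded lin_indep_one_def, rule_format, of "- of_int m" 1 0]
    by (auto simp: of_rat_minus)
  then show "frac x \<noteq> 0" by (metis frac_eq_0_iff Ints_cases)
  have "y \<noteq> of_int m" for m
    using assms[unfolded lin_indep_one_def, rule_format, of "- of_int m" 0 1]
    by (auto simp: of_rat_minus)
  then show "frac y \<noteq> 0" by (metis frac_eq_0_iff Ints_cases)
qed

text \<open>A rational relation between \<open>1, \<alpha>\<^bsub>n+1\<^esub>, \<beta>\<^bsub>n+1\<^esub>\<close>, multiplied by \<open>{\<alpha>\<^sub>n}\<close>, is a rational
  relation between \<open>1, \<alpha>\<^sub>n, \<beta>\<^sub>n\<close>.\<close>

lemma lin_indep_one_step:
  assumes "lin_indep_one x y"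
  shows "lin_indep_one (frac y / frac x) (1 / frac x)"
  unfolding lin_indep_one_def
proof (intro allI impI)
  fix u v w :: rat
  assume rel: "of_rat u + of_rat v * (frac y / frac x) + of_rat w * (1 / frac x) = 0"
  have "of_rat u * frac x + of_rat v * frac y + of_rat w = 0"
    using rel lin_indep_one_frac_nonzero(1)[OF assms] by (simp add: field_simps)
  then have "of_rat (w - u * of_int \<lfloor>x\<rfloor> - v * of_int \<lfloor>y\<rfloor>) + of_rat u * x + of_rat v * y = 0"
    by (simp add: frac_def of_rat_diff of_rat_add of_rat_mult algebra_simps)
  then have "w - u * of_int \<lfloor>x\<rfloor> - v * of_int \<lfloor>y\<rfloor> = 0 \<and> u = 0 \<and> v = 0"
    using assms unfolding lin_indep_one_def by blast
  then show "u = 0 \<and> v = 0 \<and> w = 0" by auto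
qed

lemma lin_indep_one_jp:
  assumes "lin_indep_one x y"
  shows "lin_indep_one (jp_alpha x y n) (jp_beta x y n)"
  by (induction n) (simp_all add: assms lin_indep_one_step)

lemma jp_frac_pos:
  assumes "lin_indep_one x y"
  shows "0 < frac (jp_alpha x y n)" and "0 < frac (jp_beta x y n)"
  using lin_indep_one_frac_nonzero[OF lin_indep_one_jp[OF assms, of n]]
  by (simp_all add: order_less_le)

lemma jp_a_Suc_nonneg: "0 \<le> jp_a x y (Suc n)"
  by (simp add: jp_a_def)

lemma jp_b_Suc_ge_one:
  assumes "lin_indep_one x y"
  shows "1 \<le> jp_b x y (Suc n)"
  using jp_frac_pos(1)[OF assms, of n] frac_lt_1[of "jp_alpha x y n"]
  by (simp add: jp_b_def le_floor_iff)

text \<open>The induction carries the nonnegativity of the two preceding terms, which start at 0.\<close>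

lemma jp_r_pos:
  assumes "lin_indep_one x y"
  shows "1 \<le> jp_r x y n"
proof -
  let ?r = "jp_rec (jp_a x y) (jp_b x y) 0 0 1"
  have "0 \<le> ?r n \<and> 0 \<le> ?r (Suc n) \<and> 1 \<le> ?r (Suc (Suc n))"
  proof (induction n)
    case (Suc n)
    have "1 * 1 \<le> ?r (Suc (Suc n)) * jp_b x y (Suc n)"
      using Suc.IH jp_b_Suc_ge_one[OF assms] by (intro mult_mono) auto
    moreover have "0 \<le> ?r (Suc n) * jp_a x y (Suc n)"
      using Suc.IH jp_a_Suc_nonneg by (intro mult_nonneg_nonneg) auto
    ultimately show ?case using Suc.IH by simp
  qed simp
  then show ?thesis by (simp add: jp_r_def)
qed

text \<open>A zero of \<open>\<Delta>\<close> would make \<open>\<alpha>\<^sub>0\<close> the rational number \<open>p\<^sub>n / r\<^sub>n\<close>.\<close>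

lemma jp_Delta_nonzero:
  assumes "lin_indep_one x y"
  shows "jp_Delta x y n \<noteq> 0"
proof
  assume "jp_Delta x y n = 0"
  then have "of_rat (of_int (jp_p x y n)) + of_rat (- of_int (jp_r x y n)) * x + of_rat 0 * y = 0"
    by (simp add: jp_Delta_def of_rat_minus)
  then have "- of_int (jp_r x y n) = (0 :: rat)"
    using assms unfolding lin_indep_one_def by blast
  then show False using jp_r_pos[OF assms, of n] by simp
qed

text \<open>The annihilation identity is proved for the shifted sequence \<open>D k = \<Delta>\<^bsub>k-2\<^esub>\<close>, so that the
  induction can start at the initial values 1, 0. The identity at \<open>k\<close> turns the recurrence into
  the claimed formula at \<open>k\<close>, and this formula divided by \<open>{\<alpha>\<^bsub>k+1\<^esub>}\<close> is the identity at \<open>k+1\<close>.\<close>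

lemma jp_Delta_frac_recurrence:
  assumes "lin_indep_one x y"
  shows "jp_Delta x y (Suc (Suc n)) =
    - frac (jp_beta x y (Suc (Suc n))) * jp_Delta x y (Suc n)
    - frac (jp_alpha x y (Suc (Suc n))) * jp_Delta x y n"
proof -
  define D where "D k = of_int (jp_rec (jp_a x y) (jp_b x y) 1 0 (jp_a x y 0) k)
    - x * of_int (jp_rec (jp_a x y) (jp_b x y) 0 0 1 k)" for k
  have D_rec: "D (Suc (Suc (Suc k))) = D (Suc (Suc k)) * of_int (jp_b x y (Suc k))
      + D (Suc k) * of_int (jp_a x y (Suc k)) + D k" for k
    by (simp add: D_def algebra_simps)
  have frac_step: "D (Suc (Suc (Suc k))) =
      - frac (jp_beta x y (Suc k)) * D (Suc (Suc k)) - frac (jp_alpha x y (Suc k)) * D (Suc k)"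
    if "jp_beta x y (Suc k) * D (Suc (Suc k)) + jp_alpha x y (Suc k) * D (Suc k) + D k = 0" for k
    using that D_rec[of k]
    by (simp add: frac_def jp_a_def jp_b_def algebra_simps del: jp_alpha.simps jp_beta.simps)
  have annihilate:
    "jp_beta x y (Suc k) * D (Suc (Suc k)) + jp_alpha x y (Suc k) * D (Suc k) + D k = 0" for k
  proof (induction k)
    case 0
    have "D (Suc (Suc 0)) = - frac x" "D (Suc 0) = 0" "D 0 = 1"
      by (simp_all add: D_def jp_a_def frac_def)
    then show ?case using jp_frac_pos(1)[OF assms, of 0] by simp
  next
    case (Suc k)
    have "frac (jp_alpha x y (Suc k)) \<noteq> 0"
      using jp_frac_pos(1)[OF assms, of "Suc k"] by linarith
    then show ?case
      unfolding frac_step[OF Suc.IH] jp_alpha.simps(2)[of x y "Suc k"] jp_beta.simps(2)[of x y "Suc k"]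
      by (simp add: field_simps del: jp_alpha.simps jp_beta.simps)
  qed
  have "jp_Delta x y m = D (Suc (Suc m))" for m
    by (simp add: jp_Delta_def jp_p_def jp_r_def D_def)
  then show ?thesis using frac_step[OF annihilate, of "Suc n"] by simp
qed

text \<open>If \<open>v\<close> is nonzero, then \<open>u\<close> and \<open>w\<close> lie weakly on the side opposite to \<open>v\<close>, so in
  \<open>w = - c v - d u\<close> the two terms have opposite signs and the first one prevails.\<close>

lemma abs_le_of_alternating:
  fixes u v w c d :: real
  assumes "w = - c * v - d * u" and "0 \<le> d" and "v \<noteq> 0" and "u * v \<le> 0" and "v * w \<le> 0"
  shows "\<bar>w\<bar> \<le> c * \<bar>v\<bar>"
proof (cases "0 < v")
  case True
  then have "u \<le> 0" "w \<le> 0" using assms(4,5) by (auto simp: mult_le_0_iff)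
  then have "d * u \<le> 0" using assms(2) by (simp add: mult_nonneg_nonpos)
  with True \<open>w \<le> 0\<close> assms(1) show ?thesis by simp
next
  case False
  then have "v < 0" using assms(3) by simp
  then have "0 \<le> u" "0 \<le> w" using assms(4,5) by (auto simp: mult_le_0_iff)
  then have "0 \<le> d * u" using assms(2) by simp
  with \<open>v < 0\<close> \<open>0 \<le> w\<close> assms(1) show ?thesis by simp
qed

text \<open>Eventual multiplicative decay gives \<open>\<bar>d\<^sub>n\<bar> / (c\<^sub>0 \<dots> c\<^sub>n) \<le> \<bar>d\<^sub>M\<bar> / (c\<^sub>0 \<dots> c\<^sub>M)\<close> for \<open>n \<ge> M\<close>.\<close>

lemma tendsto_zero_of_prod_decay:
  fixes c d :: "nat \<Rightarrow> real"
  assumes pos: "\<And>n. 0 < c n"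
    and decay: "\<And>n. M \<le> n \<Longrightarrow> \<bar>d (Suc n)\<bar> \<le> c (Suc n) * \<bar>d n\<bar>"
    and lim: "(\<lambda>N. \<Prod>n<N. c n) \<longlonglongrightarrow> 0"
  shows "d \<longlonglongrightarrow> 0"
proof -
  let ?P = "\<lambda>N. \<Prod>n<N. c n"
  define C where "C = \<bar>d M\<bar> / ?P (Suc M)"
  have P_pos: "0 < ?P N" for N by (simp add: prod_pos pos)
  have bound: "\<bar>d n\<bar> \<le> C * ?P (Suc n)" if "M \<le> n" for n
    using that
  proof (induction n rule: dec_induct)
    case base
    have "?P (Suc M) \<noteq> 0" using P_pos[of "Suc M"] by linarith
    then show ?case unfolding C_def by (metis nonzero_divide_eq_eq order_refl)
  next
    case (step n)
    have "\<bar>d (Suc n)\<bar> \<le> c (Suc n) * \<bar>d n\<bar>" using decay step.hyps by simp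
    also have "\<dots> \<le> c (Suc n) * (C * ?P (Suc n))"
      using step.IH pos[of "Suc n"] by (simp add: mult_left_mono)
    also have "\<dots> = C * ?P (Suc (Suc n))" by (simp add: mult_ac)
    finally show ?case .
  qed
  have "(\<lambda>n. \<bar>d n\<bar>) \<longlonglongrightarrow> 0"
  proof (rule tendsto_sandwich)
    show "\<forall>\<^sub>F n in sequentially. 0 \<le> \<bar>d n\<bar>" by simp
    show "\<forall>\<^sub>F n in sequentially. \<bar>d n\<bar> \<le> C * ?P (Suc n)"
      using bound unfolding eventually_sequentially by blast
    show "(\<lambda>n. 0 :: real) \<longlonglongrightarrow> 0" by simp
    show "(\<lambda>n. C * ?P (Suc n)) \<longlonglongrightarrow> 0"
      by (rule tendsto_mult_right_zero[OF LIMSEQ_Suc[OF lim]])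
  qed
  then show ?thesis by (rule tendsto_rabs_zero_cancel)
qed

theorem theorem2p5:
  fixes \<alpha>0 \<beta>0 :: real
  assumes "0 \<le> \<alpha>0" and "\<alpha>0 \<le> \<beta>0" and "1 \<le> \<beta>0"
    and "lin_indep_one \<alpha>0 \<beta>0"
    and "finite {n. 1 \<le> n \<and> jp_Delta \<alpha>0 \<beta>0 (n - 1) * jp_Delta \<alpha>0 \<beta>0 n > 0}"
    and "(\<lambda>N. \<Prod>n<N. frac (jp_beta \<alpha>0 \<beta>0 n)) \<longlonglongrightarrow> 0"
  shows "jp_Delta \<alpha>0 \<beta>0 \<longlonglongrightarrow> 0"
proof -
  let ?\<Delta> = "jp_Delta \<alpha>0 \<beta>0"
  note indep = \<open>lin_indep_one \<alpha>0 \<beta>0\<close>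
  obtain N where N: "\<And>n. 1 \<le> n \<Longrightarrow> ?\<Delta> (n - 1) * ?\<Delta> n > 0 \<Longrightarrow> n \<le> N"
    using assms(5) unfolding finite_nat_set_iff_bounded_le by blast
  have alt: "?\<Delta> n * ?\<Delta> (Suc n) \<le> 0" if "N \<le> n" for n
    using N[of "Suc n"] that by fastforce
  have decay: "\<bar>?\<Delta> (Suc n)\<bar> \<le> frac (jp_beta \<alpha>0 \<beta>0 (Suc n)) * \<bar>?\<Delta> n\<bar>" if "Suc N \<le> n" for n
  proof -
    obtain m where m: "n = Suc m" "N \<le> m" using \<open>Suc N \<le> n\<close> by (cases n) auto
    show ?thesis
      unfolding m(1)
      using jp_Delta_frac_recurrence[OF indep, of m] frac_ge_0 jp_Delta_nonzero[OF indep]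
        alt[of m] alt[of "Suc m"] m(2)
      by (intro abs_le_of_alternating) auto
  qed
  show ?thesis
    using jp_frac_pos(2)[OF indep] decay assms(6) by (rule tendsto_zero_of_prod_decay)
qed

end
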